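(* Let $K$ be a field and let $I$ be a nonzero proper monomial ideal of $K[x_1,\ldots,x_n]$. The naive Waldschmidt constant $\widetilde{\alpha}(I)$ is the solution (optimal value) of the linear optimization problem: minimize $y_1+\cdots+y_n$ subject to $(y_1,\ldots,y_n)\in IP(I)$, where $IP(I)$ is the irreducible polyhedron of $I$. That is, $$\widetilde{\alpha}(I)=\min\{y_1+\cdots+y_n\mid (y_1,\ldots,y_n)\in IP(I)\}.$$
   Context: For a nonzero homogeneous ideal $J$, $\alpha(J)$ is the least degree of a nonzero element of $J$. For a monomial ideal $J$, the Newton polyhedron $NP(J)\subseteq\mathbb{R}^n$ is the convex hull of the exponent vectors in $\mathbb{N}^n$ of all monomials in $J$. A proper monomial ideal is irreducible (not an intersection of two strictly larger ideals) if and only if it is generated by positive powers of some of the variables. Every proper monomial ideal can be written as a finite intersection $I=J_1\cap\cdots\cap J_s$ of irreducible monomial ideals. Set $I^{\{m\}}=J_1^m\cap\cdots\cap J_s^m$ for $m\ge1$ (the $m$-th irreducible power) and $IP(I)=NP(J_1)\cap\cdots\cap NP(J_s)$ (the irreducible polyhedron); both are independent of the chosen decomposition. The naive Waldschmidt constant is $\widetilde{\alpha}(I)=\lim_{m\to\infty}\alpha(I^{\{m\}})/m$ (the limit exists). *)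

theory Defs
  imports "HOL-Analysis.Analysis" "HOL-Library.Poly_Mapping"
begin

text \<open>The polynomial ring over \<open>'k\<close> whose variables are indexed by the finite type \<open>'n\<close>
  (so \<open>n = CARD('n)\<close>); exponent vectors are elements of \<open>'n \<Rightarrow>\<^sub>0 nat\<close>.\<close>

type_synonym ('n, 'k) mpoly = "('n \<Rightarrow>\<^sub>0 nat) \<Rightarrow>\<^sub>0 'k"


text \<open>Ideals of a commutative ring are its submodules. \<open>Modules.module\<close> is used without a global
  interpretation because that would make reversed associativity of multiplication a simp rule.\<close>

lemma module_times: "module ((*) :: 'a::comm_ring_1 \<Rightarrow> 'a \<Rightarrow> 'a)"
  by unfold_locales (simp_all add: algebra_simps)

definition is_ideal :: "'a::comm_ring_1 set \<Rightarrow> bool" where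
  "is_ideal J \<longleftrightarrow> module.subspace (*) J"

definition ideal_generated :: "'a::comm_ring_1 set \<Rightarrow> 'a set" where
  "ideal_generated S = module.span (*) S"

definition ideal_product :: "'a::comm_ring_1 set \<Rightarrow> 'a set \<Rightarrow> 'a set" where
  "ideal_product J L = ideal_generated {a * b | a b. a \<in> J \<and> b \<in> L}"

primrec ideal_power :: "'a::comm_ring_1 set \<Rightarrow> nat \<Rightarrow> 'a set" where
  "ideal_power J 0 = UNIV"
| "ideal_power J (Suc m) = ideal_product J (ideal_power J m)"

definition irreducible_ideal :: "'a::comm_ring_1 set \<Rightarrow> bool" where
  "irreducible_ideal J \<longleftrightarrow> is_ideal J \<and> J \<noteq> UNIV \<and>
     \<not> (\<exists>A B. is_ideal A \<and> is_ideal B \<and> J \<subset> A \<and> J \<subset> B \<and> J = A \<inter> B)"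


definition monomial :: "('n \<Rightarrow>\<^sub>0 nat) \<Rightarrow> ('n, 'k::field) mpoly" where
  "monomial e = Poly_Mapping.single e 1"

definition monomial_ideal :: "('n, 'k::field) mpoly set \<Rightarrow> bool" where
  "monomial_ideal J \<longleftrightarrow> (\<exists>E. J = ideal_generated (monomial ` E))"

text \<open>Only meaningful for nonzero polynomials.\<close>

definition total_degree :: "('n::finite, 'k::field) mpoly \<Rightarrow> nat" where
  "total_degree p = Max ((\<lambda>e. \<Sum>i\<in>UNIV. Poly_Mapping.lookup e i) ` Poly_Mapping.keys p)"

definition alpha :: "('n::finite, 'k::field) mpoly set \<Rightarrow> nat" where
  "alpha J = (LEAST d. \<exists>p\<in>J. p \<noteq> 0 \<and> total_degree p = d)"

definition newton_polyhedron :: "('n::finite, 'k::field) mpoly set \<Rightarrow> (real ^ 'n) set" where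
  "newton_polyhedron J =
     convex hull {(\<chi> i. real (Poly_Mapping.lookup e i)) | e. (monomial e :: ('n, 'k) mpoly) \<in> J}"


definition irreducible_decomposition ::
    "('n::finite, 'k::field) mpoly set \<Rightarrow> ('n, 'k) mpoly set set \<Rightarrow> bool" where
  "irreducible_decomposition I \<J> \<longleftrightarrow>
     finite \<J> \<and> (\<forall>J\<in>\<J>. monomial_ideal J \<and> irreducible_ideal J) \<and> I = \<Inter>\<J>"

text \<open>Every proper monomial ideal has an irreducible decomposition, and the irreducible powers and
  the irreducible polyhedron do not depend on which one is taken; so an arbitrary one is fixed.\<close>

definition irreducible_components ::
    "('n::finite, 'k::field) mpoly set \<Rightarrow> ('n, 'k) mpoly set set" where
  "irreducible_components I = (SOME \<J>. irreducible_decomposition I \<J>)"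

definition irreducible_power ::
    "('n::finite, 'k::field) mpoly set \<Rightarrow> nat \<Rightarrow> ('n, 'k) mpoly set" where
  "irreducible_power I m = (\<Inter>J\<in>irreducible_components I. ideal_power J m)"

definition irreducible_polyhedron :: "('n::finite, 'k::field) mpoly set \<Rightarrow> (real ^ 'n) set" where
  "irreducible_polyhedron I = (\<Inter>J\<in>irreducible_components I. newton_polyhedron J)"

definition naive_waldschmidt :: "('n::finite, 'k::field) mpoly set \<Rightarrow> real" where
  "naive_waldschmidt I = lim (\<lambda>m. real (alpha (irreducible_power I m)) / real m)"

end

theory Submission
  imports Defs
begin

text \<open>A monomial ideal is an up-closed set of exponents. If such a set is not of the form
  \<open>\<exists>i\<in>S. a i \<le> e i\<close>, it is the intersection of two strictly larger ones; by Dickson's lemma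
  the splitting stops, so irreducible decompositions exist, and every irreducible component is
  generated by the powers \<open>x\<^sub>i\<^bsup>a i\<^esup>\<close> with \<open>i \<in> S\<close>. For such a component \<open>J\<close> the Newton polyhedron
  is \<open>y \<ge> 0\<close>, \<open>(\<Sum>i\<in>S. y i / a i) \<ge> 1\<close>, while \<open>x\<^sup>e\<close> lies in \<open>J\<^sup>m\<close> if and only if
  \<open>(\<Sum>i\<in>S. \<lfloor>e i / a i\<rfloor>) \<ge> m\<close>. Hence the exponents of the \<open>m\<close>-th irreducible power, divided by \<open>m\<close>,
  lie in the irreducible polyhedron; conversely, if \<open>y\<close> minimizes the coordinate sum there, adding a
  constant independent of \<open>m\<close> to every coordinate of \<open>\<lceil>m y\<rceil>\<close> gives an exponent in the \<open>m\<close>-th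
  irreducible power. The two bounds on \<open>\<alpha> / m\<close> differ by \<open>O(1 / m)\<close>.\<close>

alias lookup = Poly_Mapping.lookup
alias keys = Poly_Mapping.keys
alias single = Poly_Mapping.single

section \<open>Ideals and polynomial arithmetic\<close>

lemma is_ideal_iff:
  "is_ideal J \<longleftrightarrow> 0 \<in> J \<and> (\<forall>x\<in>J. \<forall>y\<in>J. x + y \<in> J) \<and> (\<forall>c. \<forall>x\<in>J. c * x \<in> J)"
  unfolding is_ideal_def by (rule module.subspace_def[OF module_times])

lemma is_ideal_sum: "is_ideal J \<Longrightarrow> (\<And>x. x \<in> X \<Longrightarrow> f x \<in> J) \<Longrightarrow> sum f X \<in> J"
  unfolding is_ideal_def by (rule module.subspace_sum[OF module_times])

lemma is_ideal_diff: "is_ideal J \<Longrightarrow> x \<in> J \<Longrightarrow> y \<in> J \<Longrightarrow> x - y \<in> J"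
  unfolding is_ideal_def by (rule module.subspace_diff[OF module_times])

lemma is_ideal_generated: "is_ideal (ideal_generated S)"
  unfolding is_ideal_def ideal_generated_def by (rule module.subspace_span[OF module_times])

lemma ideal_generated_base: "a \<in> S \<Longrightarrow> a \<in> ideal_generated S"
  unfolding ideal_generated_def by (rule module.span_base[OF module_times])

lemma ideal_generated_minimal: "S \<subseteq> J \<Longrightarrow> is_ideal J \<Longrightarrow> ideal_generated S \<subseteq> J"
  unfolding is_ideal_def ideal_generated_def by (rule module.span_minimal[OF module_times])

lemma ideal_product_subset:
  assumes "is_ideal T" and "\<And>a b. a \<in> J \<Longrightarrow> b \<in> L \<Longrightarrow> a * b \<in> T"
  shows "ideal_product J L \<subseteq> T"
  unfolding ideal_product_def using assms by (intro ideal_generated_minimal) auto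

lemma mult_in_ideal_product: "a \<in> J \<Longrightarrow> b \<in> L \<Longrightarrow> a * b \<in> ideal_product J L"
  unfolding ideal_product_def by (rule ideal_generated_base) auto

lemma poly_mapping_expand: "p = (\<Sum>k\<in>keys p. single k (lookup p k))"
proof (rule poly_mapping_eqI)
  fix k
  have "lookup (\<Sum>k\<in>keys p. single k (lookup p k)) k = (\<Sum>l\<in>keys p. if l = k then lookup p l else 0)"
    by (simp add: lookup_sum lookup_single when_def)
  also have "\<dots> = lookup p k"
    by (simp add: in_keys_iff)
  finally show "lookup p k = lookup (\<Sum>k\<in>keys p. single k (lookup p k)) k" ..
qed

lemma monomial_nonzero [simp]: "(monomial e :: ('n, 'k::field) mpoly) \<noteq> 0"
  by (metis keys_single keys_zero insert_not_empty monomial_def one_neq_zero)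

lemma monomial_mult: "monomial (d + e) = monomial d * monomial e"
  by (simp add: monomial_def mult_single)

lemma monomial_mult_expand: "monomial t * p = (\<Sum>k\<in>keys p. single (t + k) (lookup p k))"
  by (subst poly_mapping_expand[of p]) (simp add: monomial_def sum_distrib_left mult_single)

lemma lookup_monomial_mult:
  fixes p :: "('n, 'k::field) mpoly"
  shows "lookup (monomial t * p) (t + e) = lookup p e"
proof -
  have "lookup (monomial t * p) (t + e) = (\<Sum>l\<in>keys p. if l = e then lookup p l else 0)"
    unfolding monomial_mult_expand by (simp add: lookup_sum lookup_single when_def)
  also have "\<dots> = lookup p e"
    by (simp add: in_keys_iff)
  finally show ?thesis .
qed

lemma keys_monomial_mult:
  fixes p :: "('n, 'k::field) mpoly"
  shows "keys (monomial t * p) = (+) t ` keys p"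
proof
  show "keys (monomial t * p) \<subseteq> (+) t ` keys p"
    using keys_mult[of "monomial t" p] by (auto simp: monomial_def split: if_splits)
qed (auto simp: in_keys_iff lookup_monomial_mult)

text \<open>The exponents carry no order since the variables are not ordered; numbering the variables
  embeds the exponents into a linearly ordered monoid, where leading terms exist.\<close>

lemma mpoly_mult_nonzero:
  fixes f g :: "('n::finite, 'k::field) mpoly"
  assumes "f \<noteq> 0" and "g \<noteq> 0"
  shows "f * g \<noteq> 0"
proof -
  obtain idx :: "'n \<Rightarrow> nat" where idx: "inj idx"
    using finite_imp_inj_to_nat_seg[of "UNIV :: 'n set"] by auto
  define \<phi> :: "('n \<Rightarrow>\<^sub>0 nat) \<Rightarrow> (nat \<Rightarrow>\<^sub>0 nat)"
    where "\<phi> e = (\<Sum>i\<in>UNIV. single (idx i) (lookup e i))" for e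
  have \<phi>_add: "\<phi> (d + e) = \<phi> d + \<phi> e" for d e
    by (simp add: \<phi>_def lookup_add single_add sum.distrib)
  have lookup_\<phi>: "lookup (\<phi> e) (idx i) = lookup e i" for e i
    using inj_eq[OF idx] by (simp add: \<phi>_def lookup_sum lookup_single when_def)
  have \<phi>_inj: "d = e" if "\<phi> d = \<phi> e" for d e
    by (rule poly_mapping_eqI) (metis that lookup_\<phi>)
  have lead: "\<exists>e\<in>keys p. \<forall>d\<in>keys p. d \<noteq> e \<longrightarrow> \<phi> d < \<phi> e" if "p \<noteq> 0" for p :: "('n, 'k) mpoly"
  proof -
    have "keys p \<noteq> {}" using that by (metis keys_eq_empty)
    then have "Max (\<phi> ` keys p) \<in> \<phi> ` keys p" by (intro Max_in) auto
    then obtain e where e: "e \<in> keys p" "\<phi> e = Max (\<phi> ` keys p)" by auto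
    have "\<phi> d \<le> \<phi> e" if "d \<in> keys p" for d using that e by simp
    then show ?thesis using e \<phi>_inj by (metis order_le_less)
  qed
  obtain e1 where e1: "e1 \<in> keys f" "\<And>d. d \<in> keys f \<Longrightarrow> d \<noteq> e1 \<Longrightarrow> \<phi> d < \<phi> e1"
    using lead[OF \<open>f \<noteq> 0\<close>] by blast
  obtain e2 where e2: "e2 \<in> keys g" "\<And>d. d \<in> keys g \<Longrightarrow> d \<noteq> e2 \<Longrightarrow> \<phi> d < \<phi> e2"
    using lead[OF \<open>g \<noteq> 0\<close>] by blast
  \<comment> \<open>Strict maximality of both leading exponents makes \<open>(e1, e2)\<close> the
    only pair with sum \<open>e1 + e2\<close>, so the coefficient of the product there is the
    product of two nonzero field elements.\<close>
  have eq: "k = e1 \<and> l = e2" if "k \<in> keys f" "l \<in> keys g" "k + l = e1 + e2" for k l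
  proof (rule ccontr)
    assume "\<not> ?thesis"
    then have "\<phi> k + \<phi> l < \<phi> e1 + \<phi> e2"
      using e1(2)[OF that(1)] e2(2)[OF that(2)]
      by (cases "k = e1"; cases "l = e2") (auto intro: add_strict_mono add_less_le_mono)
    then show False using that(3) by (metis \<phi>_add less_irrefl)
  qed
  have "f * g = (\<Sum>k\<in>keys f. \<Sum>l\<in>keys g. single (k + l) (lookup f k * lookup g l))"
    by (subst poly_mapping_expand[of f], subst poly_mapping_expand[of g])
      (simp add: sum_product mult_single)
  then have "lookup (f * g) (e1 + e2) =
      (\<Sum>k\<in>keys f. \<Sum>l\<in>keys g. if k + l = e1 + e2 then lookup f k * lookup g l else 0)"
    by (simp add: lookup_sum lookup_single when_def)
  also have "\<dots> = (\<Sum>k\<in>keys f. \<Sum>l\<in>keys g. if k = e1 \<and> l = e2 then lookup f k * lookup g l else 0)"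
    using eq by (intro sum.cong refl) auto
  also have "\<dots> = (\<Sum>k\<in>keys f. if k = e1 then lookup f e1 * lookup g e2 else 0)"
    using e2(1) by (intro sum.cong refl) auto
  also have "\<dots> = lookup f e1 * lookup g e2"
    using e1(1) by simp
  finally have "lookup (f * g) (e1 + e2) \<noteq> 0"
    using e1(1) e2(1) by (simp add: in_keys_iff)
  then show ?thesis by auto
qed

subsection \<open>Monomial ideals as up-closed sets of exponents\<close>

definition upset :: "('n \<Rightarrow>\<^sub>0 nat) set \<Rightarrow> bool" where
  "upset U \<longleftrightarrow> (\<forall>e\<in>U. \<forall>d. e + d \<in> U)"

text \<open>The linear span of the monomials with exponents in \<open>U\<close>. It is an ideal
  exactly when \<open>U\<close> is up-closed; questions about monomial ideals then become questions
  about sets of exponents.\<close>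

definition mon_ideal :: "('n \<Rightarrow>\<^sub>0 nat) set \<Rightarrow> ('n, 'k::field) mpoly set" where
  "mon_ideal U = {p. keys p \<subseteq> U}"

lemma upsetD:
  assumes "upset U" and "e \<in> U" and "\<And>i. lookup e i \<le> lookup d i"
  shows "d \<in> U"
proof -
  have "d = e + (d - e)"
    using assms(3) by (intro poly_mapping_eqI) (simp add: lookup_add lookup_minus)
  then show ?thesis using assms(1,2) unfolding upset_def by metis
qed

lemma monomial_in_mon_ideal [simp]: "monomial e \<in> (mon_ideal U :: ('n, 'k::field) mpoly set) \<longleftrightarrow> e \<in> U"
  by (simp add: monomial_def mon_ideal_def)

lemma mon_ideal_eq_iff [simp]: "(mon_ideal U :: ('n, 'k::field) mpoly set) = mon_ideal V \<longleftrightarrow> U = V"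
  by (metis monomial_in_mon_ideal subsetI subset_antisym)

lemma mon_ideal_subset_iff [simp]: "(mon_ideal U :: ('n, 'k::field) mpoly set) \<subseteq> mon_ideal V \<longleftrightarrow> U \<subseteq> V"
  by (metis (no_types, lifting) mem_Collect_eq mon_ideal_def monomial_in_mon_ideal subsetD subsetI subset_trans)

lemma mon_ideal_psubset_iff [simp]: "(mon_ideal U :: ('n, 'k::field) mpoly set) \<subset> mon_ideal V \<longleftrightarrow> U \<subset> V"
  by (simp add: psubset_eq)

lemma mon_ideal_Int: "mon_ideal (U \<inter> V) = mon_ideal U \<inter> mon_ideal V"
  by (auto simp: mon_ideal_def)

lemma mon_ideal_UNIV [simp]: "mon_ideal UNIV = UNIV"
  by (simp add: mon_ideal_def)

lemma is_ideal_mon_ideal: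
  fixes U :: "('n \<Rightarrow>\<^sub>0 nat) set"
  assumes "upset U"
  shows "is_ideal (mon_ideal U :: ('n, 'k::field) mpoly set)"
proof -
  have "c * x \<in> mon_ideal U" if "x \<in> mon_ideal U" for c x :: "('n, 'k) mpoly"
  proof -
    have "k \<in> U" if "k \<in> keys (c * x)" for k
    proof -
      obtain a b where "k = a + b" "b \<in> keys x" using \<open>k \<in> keys (c * x)\<close> keys_mult[of c x] by blast
      then show "k \<in> U" using assms \<open>x \<in> mon_ideal U\<close>
        unfolding upset_def mon_ideal_def by (metis add.commute mem_Collect_eq subsetD)
    qed
    then show ?thesis by (auto simp: mon_ideal_def)
  qed
  moreover have "x + y \<in> mon_ideal U" if "x \<in> mon_ideal U" "y \<in> mon_ideal U" for x y :: "('n, 'k) mpoly"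
    using that keys_add[of x y] by (auto simp: mon_ideal_def)
  ultimately show ?thesis unfolding is_ideal_iff by (simp add: mon_ideal_def)
qed

lemma single_eq_mult_monomial: "single e c = single 0 c * monomial e"
  by (simp add: monomial_def mult_single)

lemma mon_ideal_subset:
  fixes J :: "('n, 'k::field) mpoly set"
  assumes J: "is_ideal J" and sub: "\<And>e. e \<in> U \<Longrightarrow> monomial e \<in> J"
  shows "mon_ideal U \<subseteq> J"
proof
  fix p :: "('n, 'k) mpoly" assume "p \<in> mon_ideal U"
  then have "keys p \<subseteq> U" by (simp add: mon_ideal_def)
  then have "single k (lookup p k) \<in> J" if "k \<in> keys p" for k
    using that sub J unfolding is_ideal_iff by (subst single_eq_mult_monomial) blast
  then have "(\<Sum>k\<in>keys p. single k (lookup p k)) \<in> J"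
    by (rule is_ideal_sum[OF J])
  then show "p \<in> J" using poly_mapping_expand[of p] by simp
qed

text \<open>The exponents of all multiples of the generators form the up-closed set
  \<open>U\<close>; conversely, an up-closed set serves as its own set of generators.\<close>

lemma monomial_ideal_iff:
  fixes J :: "('n, 'k::field) mpoly set"
  shows "monomial_ideal J \<longleftrightarrow> (\<exists>U. upset U \<and> J = mon_ideal U)"
proof
  assume "monomial_ideal J"
  then obtain E where E: "J = ideal_generated (monomial ` E)"
    unfolding monomial_ideal_def by blast
  define U where "U = {e + d | e d. e \<in> E}"
  have "upset U" unfolding upset_def U_def by (force simp: add.assoc)
  have sub: "E \<subseteq> U" unfolding U_def by (force intro: add_0_right[symmetric])
  have J: "is_ideal J" unfolding E by (rule is_ideal_generated)
  have "J \<subseteq> mon_ideal U"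
    unfolding E using sub by (intro ideal_generated_minimal is_ideal_mon_ideal \<open>upset U\<close>) auto
  moreover have "mon_ideal U \<subseteq> J"
  proof (rule mon_ideal_subset[OF J])
    fix u assume "u \<in> U"
    then obtain e d where "u = e + d" "e \<in> E" unfolding U_def mem_Collect_eq by (elim exE conjE)
    then have "monomial u = monomial d * (monomial e :: ('n, 'k) mpoly)"
      by (simp add: add.commute flip: monomial_mult)
    moreover have "monomial e \<in> J" using \<open>e \<in> E\<close> unfolding E by (intro ideal_generated_base) simp
    ultimately show "monomial u \<in> J" using J unfolding is_ideal_iff by simp
  qed
  ultimately show "\<exists>U. upset U \<and> J = mon_ideal U" using \<open>upset U\<close> by blast
next
  assume "\<exists>U. upset U \<and> J = mon_ideal U"
  then obtain U where U: "upset U" "J = mon_ideal U" by blast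
  have "J = ideal_generated (monomial ` U)"
  proof
    show "J \<subseteq> ideal_generated (monomial ` U)"
      unfolding U(2) by (rule mon_ideal_subset[OF is_ideal_generated]) (simp add: ideal_generated_base)
    show "ideal_generated (monomial ` U) \<subseteq> J"
      using U by (intro ideal_generated_minimal) (auto simp: is_ideal_mon_ideal)
  qed
  then show "monomial_ideal J" unfolding monomial_ideal_def by blast
qed

subsection \<open>Irreducible monomial ideals\<close>

text \<open>For \<open>a\<close> positive on \<open>S\<close>, these are the exponents of the
  monomials in the ideal generated by the powers \<open>x_i^(a i)\<close>, \<open>i \<in> S\<close>.
  The empty \<open>S\<close> encodes the zero ideal.\<close>

definition pure_upset :: "'n set \<Rightarrow> ('n \<Rightarrow> nat) \<Rightarrow> ('n \<Rightarrow>\<^sub>0 nat) set" where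
  "pure_upset S a = {e. \<exists>i\<in>S. a i \<le> lookup e i}"

lemma upset_pure: "upset (pure_upset S a)"
  unfolding upset_def pure_upset_def by (auto simp: lookup_add intro: trans_le_add1)

text \<open>A generator \<open>v + w\<close> with \<open>v\<close>, \<open>w\<close> of disjoint nonempty supports splits the ideal: a monomial
  divisible by both \<open>x\<^sup>v\<close> and \<open>x\<^sup>w\<close> is divisible by their product.\<close>

lemma upset_split:
  fixes U :: "('n::finite \<Rightarrow>\<^sub>0 nat) set"
  assumes U: "upset U" and "0 \<notin> U"
    and nonpure: "\<nexists>S a. (\<forall>i\<in>S. 0 < a i) \<and> U = pure_upset S a"
  shows "\<exists>A B. upset A \<and> upset B \<and> U \<subset> A \<and> U \<subset> B \<and> U = A \<inter> B"
proof -
  \<comment> \<open>\<open>S\<close> collects the variables with a pure power in the ideal, and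
    \<open>a\<close> the least such powers: the only candidates for a description as
    \<open>pure_upset\<close>.\<close>
  define S where "S = {i. \<exists>k. single i k \<in> U}"
  define a where "a i = (LEAST k. single i k \<in> U)" for i
  have a: "single i (a i) \<in> U" if "i \<in> S" for i
    using that unfolding S_def a_def by (auto intro: LeastI)
  have pos: "\<forall>i\<in>S. 0 < a i"
    using a \<open>0 \<notin> U\<close> by (metis gr0I single_zero)
  have "pure_upset S a \<subseteq> U"
  proof
    fix e assume "e \<in> pure_upset S a"
    then obtain i where "i \<in> S" "a i \<le> lookup e i" unfolding pure_upset_def by auto
    then show "e \<in> U"
      by (intro upsetD[OF U a[of i]]) (auto simp: lookup_single when_def)
  qed
  with nonpure pos have "\<exists>e. e \<in> U - pure_upset S a" by blast
  \<comment> \<open>Smallest support is what keeps \<open>w\<close>, which is \<open>e\<close>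
    without one of its variables, out of \<open>U\<close>. The other part \<open>v\<close> is a pure
    power, hence outside \<open>U\<close> because \<open>e\<close> is outside
    \<open>pure_upset S a\<close>.\<close>
  then obtain e where e: "e \<in> U - pure_upset S a"
    and least: "\<And>d. d \<in> U - pure_upset S a \<Longrightarrow> card (keys e) \<le> card (keys d)"
    using ex_has_least_nat[of "\<lambda>e. e \<in> U - pure_upset S a" _ "\<lambda>e. card (keys e)"] by blast
  have "e \<noteq> 0" using e \<open>0 \<notin> U\<close> by auto
  then obtain i where i: "i \<in> keys e" by (metis all_not_in_conv keys_eq_empty)
  define v where "v = single i (lookup e i)"
  define w where "w = e - v"
  have v: "lookup v j = (if j = i then lookup e i else 0)" for j
    unfolding v_def by (auto simp: lookup_single when_def)
  have w: "lookup w j = (if j = i then 0 else lookup e j)" for j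
    unfolding w_def by (auto simp: lookup_minus v)
  have "v \<notin> U"
  proof
    assume "v \<in> U"
    then have "i \<in> S" "a i \<le> lookup e i"
      unfolding S_def a_def v_def by (auto intro: Least_le)
    then show False using e unfolding pure_upset_def by auto
  qed
  have "w \<notin> U"
  proof
    assume "w \<in> U"
    moreover have "w \<notin> pure_upset S a"
      using e pos unfolding pure_upset_def by (auto simp: w)
    ultimately have "card (keys e) \<le> card (keys w)" using least by blast
    moreover have "keys w \<subset> keys e" using i by (auto simp: in_keys_iff w split: if_splits)
    then have "card (keys w) < card (keys e)" by (intro psubset_card_mono) auto
    ultimately show False by simp
  qed
  let ?up = "\<lambda>u. U \<union> range ((+) u)"
  have up: "upset (?up u)" for u
    using U unfolding upset_def by (auto simp: add.assoc)
  have self: "u \<in> ?up u" for u by (auto intro: rangeI image_eqI[of _ _ 0])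
  have "x \<in> U" if "x = v + s" "x = w + t" for x s t :: "'n \<Rightarrow>\<^sub>0 nat"
  proof (rule upsetD[OF U])
    show "e \<in> U" using e by simp
    show "lookup e j \<le> lookup x j" for j
      using arg_cong[OF that(1), of "\<lambda>x. lookup x j"] arg_cong[OF that(2), of "\<lambda>x. lookup x j"]
      by (cases "j = i") (auto simp: lookup_add v w)
  qed
  then have "range ((+) v) \<inter> range ((+) w) \<subseteq> U" by blast
  then have "U = ?up v \<inter> ?up w" by blast
  moreover have "U \<subset> ?up v" "U \<subset> ?up w"
    using self[of v] self[of w] \<open>v \<notin> U\<close> \<open>w \<notin> U\<close> by auto
  ultimately show ?thesis using up[of v] up[of w] by (intro exI conjI)
qed

text \<open>The socle of the quotient by a pure power ideal: modulo the ideal, a polynomial outside it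
  has a multiple of the form \<open>x\<^sup>s * g\<close>, where \<open>s i = a i - 1\<close> on \<open>S\<close> and \<open>g\<close> involves
  only the variables outside \<open>S\<close>.\<close>

lemma socle_multiple:
  fixes J :: "('n::finite, 'k::field) mpoly set" and S :: "'n set" and a :: "'n \<Rightarrow> nat"
  defines "s \<equiv> Abs_poly_mapping (\<lambda>i. if i \<in> S then a i - 1 else 0)"
  assumes pos: "\<forall>i\<in>S. 0 < a i" and J: "is_ideal J" and sub: "mon_ideal (pure_upset S a) \<subset> J"
  shows "\<exists>g. g \<noteq> 0 \<and> (\<forall>e\<in>keys g. \<forall>i\<in>S. lookup e i = 0) \<and> monomial s * g \<in> J"
proof -
  let ?P = "pure_upset S a"
  let ?w = "\<lambda>e :: 'n \<Rightarrow>\<^sub>0 nat. \<Sum>i\<in>S. lookup e i"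
  obtain f where f: "f \<in> J" "f \<notin> mon_ideal ?P" using sub by blast
  then have "\<exists>e. e \<in> keys f - ?P" by (auto simp: mon_ideal_def)
  \<comment> \<open>Among the exponents of \<open>f\<close> outside the ideal, \<open>e\<close> has
    least degree in the variables of \<open>S\<close>.\<close>
  then obtain e where e: "e \<in> keys f - ?P"
    and least: "\<And>d. d \<in> keys f - ?P \<Longrightarrow> ?w e \<le> ?w d"
    using ex_has_least_nat[of "\<lambda>e. e \<in> keys f - ?P" _ ?w] by blast
  \<comment> \<open>Multiplication by \<open>x^t\<close> lifts \<open>e\<close> to \<open>s\<close>
    on \<open>S\<close>, the largest values still outside the ideal. The product \<open>F\<close>
    then splits into \<open>R\<close> inside the ideal and \<open>G\<close> outside it.\<close>
  define t where "t = Abs_poly_mapping (\<lambda>i. if i \<in> S then a i - 1 - lookup e i else 0)"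
  define F where "F = monomial t * f"
  define R where "R = (\<Sum>k\<in>keys F \<inter> ?P. single k (lookup F k))"
  define G where "G = (\<Sum>k\<in>keys F - ?P. single k (lookup F k))"
  define g where "g = (\<Sum>k\<in>keys F - ?P. single (k - s) (lookup F k))"
  have "F \<in> J" using J f unfolding F_def is_ideal_iff by blast
  have "R \<in> mon_ideal ?P"
    unfolding R_def by (rule is_ideal_sum[OF is_ideal_mon_ideal[OF upset_pure]]) (auto simp: mon_ideal_def)
  have "F = R + G"
    unfolding R_def G_def using poly_mapping_expand[of F] sum.Int_Diff[OF finite_keys[of F]]
    by (rule trans)
  then have "G = F - R" by simp
  then have "G \<in> J" using \<open>F \<in> J\<close> \<open>R \<in> mon_ideal ?P\<close> sub is_ideal_diff[OF J] by blast
  \<comment> \<open>If \<open>t + d\<close> is outside the ideal, then \<open>d \<le> e\<close> on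
    \<open>S\<close>; the least degree of \<open>e\<close> forces equality on \<open>S\<close>. So
    every surviving exponent agrees with \<open>s\<close> there.\<close>
  have key: "lookup k i = lookup s i" if k: "k \<in> keys F - ?P" and "i \<in> S" for k i
  proof -
    obtain d where d: "d \<in> keys f" "k = t + d"
      using k unfolding F_def keys_monomial_mult by auto
    have lt: "lookup d j \<le> lookup e j" if "j \<in> S" for j
      using k that e pos[rule_format, OF that] unfolding d pure_upset_def t_def
      by (force simp: lookup_add)
    have "d \<notin> ?P" using k upset_pure[of S a] unfolding d upset_def by (metis DiffD2 add.commute)
    with d least have "?w e \<le> ?w d" by blast
    then have "lookup d i = lookup e i"
      using lt \<open>i \<in> S\<close> sum_strict_mono_ex1[of S "lookup d" "lookup e"]
      by (force simp: order_le_less)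
    moreover have "lookup e i < a i" using e \<open>i \<in> S\<close> unfolding pure_upset_def by force
    ultimately show ?thesis using \<open>i \<in> S\<close> unfolding d t_def s_def by (simp add: lookup_add)
  qed
  \<comment> \<open>The truncated subtraction loses nothing: \<open>k\<close> equals
    \<open>s\<close> on \<open>S\<close>, and \<open>s\<close> vanishes elsewhere.\<close>
  have shift: "s + (k - s) = k" if k: "k \<in> keys F - ?P" for k
  proof (rule poly_mapping_eqI)
    fix i show "lookup (s + (k - s)) i = lookup k i"
      using key[OF k, of i] by (cases "i \<in> S") (simp_all add: lookup_add lookup_minus s_def)
  qed
  have "monomial s * g = (\<Sum>k\<in>keys F - ?P. single (s + (k - s)) (lookup F k))"
    unfolding g_def by (simp add: monomial_def sum_distrib_left mult_single)
  also have "\<dots> = G" unfolding G_def using shift by simp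
  finally have "monomial s * g = G" .
  moreover have "g \<noteq> 0"
  proof
    assume "g = 0"
    then have "F = R" using \<open>monomial s * g = G\<close> \<open>F = R + G\<close> by simp
    then have "t + e \<in> ?P"
      using \<open>R \<in> mon_ideal ?P\<close> e unfolding F_def mon_ideal_def by (auto simp: keys_monomial_mult)
    then obtain i where "i \<in> S" "a i \<le> lookup (t + e) i" unfolding pure_upset_def by blast
    moreover have "lookup e i < a i" using e \<open>i \<in> S\<close> unfolding pure_upset_def by force
    ultimately show False unfolding t_def by (simp add: lookup_add)
  qed
  moreover have "lookup d i = 0" if "d \<in> keys g" "i \<in> S" for d i
  proof -
    have "keys g \<subseteq> (\<Union>k\<in>keys F - ?P. keys (single (k - s) (lookup F k)))"
      unfolding g_def by (rule keys_sum)
    with \<open>d \<in> keys g\<close> obtain k where "k \<in> keys F - ?P" "d = k - s" by (auto split: if_splits)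
    then show ?thesis using key \<open>i \<in> S\<close> by (simp add: lookup_minus)
  qed
  ultimately show ?thesis using \<open>G \<in> J\<close> by blast
qed

text \<open>Two strictly larger ideals, monomial or not, contain \<open>x^s * g\<close> and
  \<open>x^s * h\<close> with \<open>g\<close>, \<open>h\<close> nonzero and free of the variables
  of \<open>S\<close>. Then \<open>x^s * g * h\<close> lies in both; it is nonzero, but none of its
  exponents reaches any \<open>a i\<close> on \<open>S\<close>.\<close>

lemma irreducible_pure:
  fixes a :: "'n::finite \<Rightarrow> nat"
  assumes pos: "\<forall>i\<in>S. 0 < a i"
  shows "irreducible_ideal (mon_ideal (pure_upset S a) :: ('n, 'k::field) mpoly set)"
proof -
  let ?P = "pure_upset S a" and ?s = "Abs_poly_mapping (\<lambda>i. if i \<in> S then a i - 1 else 0)"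
  let ?Q = "mon_ideal ?P :: ('n, 'k) mpoly set"
  have False if A: "is_ideal A" "?Q \<subset> A" and B: "is_ideal B" "?Q \<subset> B" and "?Q = A \<inter> B" for A B
  proof -
    obtain g where g: "g \<noteq> 0" "\<forall>e\<in>keys g. \<forall>i\<in>S. lookup e i = 0" "monomial ?s * g \<in> A"
      using socle_multiple[OF pos A] by blast
    obtain h where h: "h \<noteq> 0" "\<forall>e\<in>keys h. \<forall>i\<in>S. lookup e i = 0" "monomial ?s * h \<in> B"
      using socle_multiple[OF pos B] by blast
    have "h * (monomial ?s * g) \<in> A" "g * (monomial ?s * h) \<in> B"
      using A B g h unfolding is_ideal_iff by blast+
    then have "monomial ?s * (g * h) \<in> ?Q"
      using \<open>?Q = A \<inter> B\<close> by (simp add: ac_simps)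
    then have sub: "(+) ?s ` keys (g * h) \<subseteq> ?P"
      unfolding mon_ideal_def by (simp add: keys_monomial_mult)
    have "keys (g * h) \<noteq> {}" using mpoly_mult_nonzero[OF g(1) h(1)] by (metis keys_eq_empty)
    then obtain k where k: "k \<in> keys (g * h)" by blast
    then obtain d e where "k = d + e" "d \<in> keys g" "e \<in> keys h" using keys_mult[of g h] by blast
    moreover obtain i where "i \<in> S" "a i \<le> lookup (?s + k) i"
      using sub k unfolding pure_upset_def by blast
    ultimately show False using g(2) h(2) pos by (force simp: lookup_add)
  qed
  moreover have "?Q \<noteq> UNIV"
  proof
    assume "?Q = UNIV"
    then have "(0 :: 'n \<Rightarrow>\<^sub>0 nat) \<in> ?P" by (metis UNIV_I monomial_in_mon_ideal)
    then show False using pos unfolding pure_upset_def by auto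
  qed
  ultimately show ?thesis
    unfolding irreducible_ideal_def using is_ideal_mon_ideal[OF upset_pure] by blast
qed

lemma zero_in_upset: "upset U \<Longrightarrow> 0 \<in> U \<Longrightarrow> U = UNIV"
  unfolding upset_def by (metis UNIV_eq_I add_0)

text \<open>Otherwise \<open>upset_split\<close> would write the ideal as an intersection of two
  larger monomial ideals.\<close>

lemma irreducible_monomial_ideal_pure:
  fixes J :: "('n::finite, 'k::field) mpoly set"
  assumes "monomial_ideal J" and irr: "irreducible_ideal J"
  obtains S a where "\<forall>i\<in>S. 0 < a i" and "J = mon_ideal (pure_upset S a)"
proof -
  obtain U where U: "upset U" "J = mon_ideal U" using assms(1) unfolding monomial_ideal_iff by blast
  have "0 \<notin> U" using zero_in_upset[OF U(1)] irr U(2) unfolding irreducible_ideal_def by auto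
  have "\<exists>S a. (\<forall>i\<in>S. 0 < a i) \<and> U = pure_upset S a"
  proof (rule ccontr)
    assume "\<not> ?thesis"
    then obtain A B where AB: "upset A" "upset B" "U \<subset> A" "U \<subset> B" "U = A \<inter> B"
      using upset_split[OF U(1) \<open>0 \<notin> U\<close>] by metis
    have "\<exists>A B. is_ideal A \<and> is_ideal B \<and> J \<subset> A \<and> J \<subset> B \<and> J = A \<inter> B"
    proof (rule exI[of _ "mon_ideal A"], rule exI[of _ "mon_ideal B"], intro conjI)
      show "J \<subset> mon_ideal A" "J \<subset> mon_ideal B"
        using AB(3,4) unfolding U(2) mon_ideal_psubset_iff by simp_all
      show "J = mon_ideal A \<inter> mon_ideal B"
        unfolding U(2) AB(5) by (rule mon_ideal_Int)
    qed (intro is_ideal_mon_ideal AB)+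
    then show False using irr unfolding irreducible_ideal_def by simp
  qed
  then show ?thesis using that U(2) by blast
qed

subsection \<open>Existence of irreducible decompositions\<close>

text \<open>Every sequence has a monotone subsequence, and a decreasing one in the naturals is
  constant from the point where it attains its minimum.\<close>

lemma nat_incseq_subseq:
  fixes f :: "nat \<Rightarrow> nat"
  shows "\<exists>r. strict_mono r \<and> incseq (f \<circ> r)"
proof -
  obtain r where r: "strict_mono r" "monoseq (\<lambda>n. f (r n))" using seq_monosub[of f] by (elim exE conjE) (rule that)
  show ?thesis
  proof (cases "incseq (\<lambda>n. f (r n))")
    case True then show ?thesis using r(1) by (auto simp: o_def)
  next
    case False
    then have dec: "decseq (\<lambda>n. f (r n))" using r(2) by (simp add: monoseq_iff)
    obtain N where N: "\<And>n. f (r N) \<le> f (r n)"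
      using ex_has_least_nat[of "\<lambda>_. True" 0 "\<lambda>n. f (r n)"] by auto
    have "f (r (n + N)) = f (r N)" for n
      using N[of "n + N"] decseqD[OF dec, of N "n + N"] by simp
    then have "incseq (f \<circ> (\<lambda>n. r (n + N)))" by (simp add: incseq_def)
    moreover have "strict_mono (\<lambda>n. r (n + N))" using r(1) by (simp add: strict_mono_def)
    ultimately show ?thesis by blast
  qed
qed

text \<open>Dickson's lemma for sequences: subsequences are extracted for one variable after
  another, and each extraction preserves the monotonicity already gained.\<close>

lemma dickson_incseq_subseq:
  fixes u :: "nat \<Rightarrow> 'n::finite \<Rightarrow>\<^sub>0 nat"
  shows "\<exists>r. strict_mono r \<and> (\<forall>i. incseq (\<lambda>n. lookup (u (r n)) i))"
proof -
  have "\<exists>r. strict_mono r \<and> (\<forall>i\<in>X. incseq (\<lambda>n. lookup (u (r n)) i))" if "finite X" for X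
    using that
  proof induction
    case empty
    show ?case using strict_mono_id by blast
  next
    case (insert x X)
    then obtain r where r: "strict_mono r" "\<And>i. i \<in> X \<Longrightarrow> incseq (\<lambda>n. lookup (u (r n)) i)" by blast
    obtain q where q: "strict_mono q" "incseq ((\<lambda>n. lookup (u (r n)) x) \<circ> q)"
      using nat_incseq_subseq by blast
    have "incseq (\<lambda>n. lookup (u ((r \<circ> q) n)) i)" if "i \<in> insert x X" for i
    proof (cases "i = x")
      case True then show ?thesis using q(2) by (simp add: o_def)
    next
      case False
      then have "incseq (\<lambda>n. lookup (u (r n)) i)" using that r(2) by blast
      then show ?thesis using strict_mono_less_eq[OF q(1)] by (simp add: incseq_def)
    qed
    then show ?case using strict_mono_o[OF r(1) q(1)] by blast
  qed
  from this[of UNIV] show ?thesis by simp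
qed

text \<open>The ascending chain condition. Picking a new exponent \<open>u n\<close> at each stage,
  Dickson's lemma makes \<open>u (r 1)\<close> dominate \<open>u (r 0)\<close>, so
  \<open>u (r 1)\<close> was present too early to be new.\<close>

lemma wf_upset_supset:
  "wf {(V, U). upset (U :: ('n::finite \<Rightarrow>\<^sub>0 nat) set) \<and> U \<subset> V}"
  unfolding wf_iff_no_infinite_down_chain
proof
  assume "\<exists>U. \<forall>n. (U (Suc n), U n) \<in> {(V, U). upset (U :: ('n \<Rightarrow>\<^sub>0 nat) set) \<and> U \<subset> V}"
  then obtain U :: "nat \<Rightarrow> ('n \<Rightarrow>\<^sub>0 nat) set"
    where U: "\<And>n. upset (U n)" "\<And>n. U n \<subset> U (Suc n)"
    by (simp only: mem_Collect_eq case_prod_conv) metis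
  have "\<exists>x. x \<in> U (Suc n) - U n" for n using U(2)[of n] by auto
  then obtain u where u: "\<And>n. u n \<in> U (Suc n) - U n" by metis
  obtain r where r: "strict_mono r" "\<And>i. incseq (\<lambda>n. lookup (u (r n)) i)"
    using dickson_incseq_subseq by blast
  have "lookup (u (r 0)) i \<le> lookup (u (r 1)) i" for i
    using incseqD[OF r(2), of 0 1] by simp
  then have "u (r 1) \<in> U (Suc (r 0))"
    using upsetD[OF U(1)] u by blast
  moreover have "U (Suc (r 0)) \<subseteq> U (r 1)"
  proof (rule lift_Suc_mono_le[of U])
    show "U n \<subseteq> U (Suc n)" for n using U(2)[of n] by (rule psubset_imp_subset)
    show "Suc (r 0) \<le> r 1" using strict_monoD[OF r(1), of 0 1] by simp
  qed
  ultimately show False using u by blast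
qed

text \<open>Noetherian induction: a set that is not pure splits into two larger ones, whose
  decompositions are united.\<close>

lemma irreducible_decomposition_exists:
  fixes U :: "('n::finite \<Rightarrow>\<^sub>0 nat) set"
  assumes "upset U" and "0 \<notin> U"
  shows "\<exists>\<J>. irreducible_decomposition (mon_ideal U :: ('n, 'k::field) mpoly set) \<J>"
  using wf_upset_supset assms
proof (induction U rule: wf_induct_rule)
  case (less U)
  show ?case
  proof (cases "\<exists>S a. (\<forall>i\<in>S. 0 < a i) \<and> U = pure_upset S a")
    case True
    then have "irreducible_decomposition (mon_ideal U :: ('n, 'k) mpoly set) {mon_ideal U}"
      using irreducible_pure less.prems(1) unfolding irreducible_decomposition_def monomial_ideal_iff by auto
    then show ?thesis by blast
  next
    case False
    then obtain A B where AB: "upset A" "upset B" "U \<subset> A" "U \<subset> B" "U = A \<inter> B"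
      using upset_split[OF less.prems] by blast
    then have "0 \<notin> A" "0 \<notin> B" using zero_in_upset by auto
    obtain \<J>A :: "('n, 'k) mpoly set set" where "irreducible_decomposition (mon_ideal A) \<J>A"
      using less.IH[of A] AB less.prems \<open>0 \<notin> A\<close> by blast
    moreover obtain \<J>B :: "('n, 'k) mpoly set set" where "irreducible_decomposition (mon_ideal B) \<J>B"
      using less.IH[of B] AB less.prems \<open>0 \<notin> B\<close> by blast
    ultimately have "irreducible_decomposition (mon_ideal U :: ('n, 'k) mpoly set) (\<J>A \<union> \<J>B)"
      unfolding irreducible_decomposition_def AB(5) mon_ideal_Int by auto
    then show ?thesis by blast
  qed
qed

text \<open>Justifies the choice made by \<open>SOME\<close>; the main proof relies on nothing else
  about the chosen components.\<close>

lemma irreducible_components_decomposition: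
  fixes I :: "('n::finite, 'k::field) mpoly set"
  assumes "monomial_ideal I" and "I \<noteq> UNIV"
  shows "irreducible_decomposition I (irreducible_components I)"
proof -
  obtain U where U: "upset U" "I = mon_ideal U" using assms(1) unfolding monomial_ideal_iff by blast
  then have "0 \<notin> U" using zero_in_upset assms(2) by fastforce
  then show ?thesis
    unfolding irreducible_components_def U(2)
    by (rule someI_ex[OF irreducible_decomposition_exists[OF U(1)]])
qed

subsection \<open>The Newton polyhedron of a pure power ideal\<close>

definition exponent_vector :: "('n \<Rightarrow>\<^sub>0 nat) \<Rightarrow> real ^ 'n::finite" where
  "exponent_vector e = (\<chi> i. real (lookup e i))"

lemma exponent_vector_nth [simp]: "exponent_vector e $ i = real (lookup e i)"
  by (simp add: exponent_vector_def)

lemma newton_polyhedron_mon_ideal: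
  "newton_polyhedron (mon_ideal U :: ('n::finite, 'k::field) mpoly set) = convex hull (exponent_vector ` U)"
proof -
  have "{(\<chi> i. real (lookup e i)) | e. (monomial e :: ('n, 'k) mpoly) \<in> mon_ideal U} = exponent_vector ` U"
    by (auto simp: exponent_vector_def)
  then show ?thesis unfolding newton_polyhedron_def by simp
qed

text \<open>Up-closedness gives invariance of the hull under integer translations along an axis. A
  real step \<open>t\<close> is reached by convexity, between \<open>y\<close> and its translate by
  some integer \<open>N > t\<close>.\<close>

lemma hull_add_axis:
  fixes U :: "('n::finite \<Rightarrow>\<^sub>0 nat) set"
  assumes U: "upset U" and y: "y \<in> convex hull (exponent_vector ` U)" and "0 \<le> t"
  shows "y + t *\<^sub>R axis j 1 \<in> convex hull (exponent_vector ` U)" (is "_ \<in> ?H")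
proof -
  obtain N :: nat where N: "t < real N" using reals_Archimedean2 by blast
  let ?a = "real N *\<^sub>R axis j 1 :: real ^ 'n"
  have shift: "?a + exponent_vector e = exponent_vector (e + single j N)" for e
    by (simp add: vec_eq_iff axis_def lookup_add lookup_single when_def)
  have "(+) ?a ` exponent_vector ` U \<subseteq> exponent_vector ` U"
    using U shift unfolding upset_def by auto
  then have "convex hull ((+) ?a ` exponent_vector ` U) \<subseteq> ?H" by (rule hull_mono)
  then have "(+) ?a ` ?H \<subseteq> ?H" by (simp only: convex_hull_translation)
  then have "?a + y \<in> ?H" using y by blast
  then have "(1 - t / N) *\<^sub>R y + (t / N) *\<^sub>R (?a + y) \<in> ?H"
    using y N \<open>0 \<le> t\<close> by (intro convexD) auto
  moreover have "(1 - t / N) *\<^sub>R y + (t / N) *\<^sub>R (?a + y) = y + t *\<^sub>R axis j 1"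
    using N \<open>0 \<le> t\<close> by (simp add: algebra_simps)
  ultimately show ?thesis by simp
qed

lemma hull_add_nonneg:
  fixes U :: "('n::finite \<Rightarrow>\<^sub>0 nat) set"
  assumes U: "upset U" and y: "y \<in> convex hull (exponent_vector ` U)" and z: "\<And>i. 0 \<le> z $ i"
  shows "y + z \<in> convex hull (exponent_vector ` U)" (is "_ \<in> ?H")
proof -
  have "y + (\<Sum>i\<in>X. z $ i *\<^sub>R axis i 1) \<in> ?H" if "finite X" for X
    using that
  proof induction
    case (insert x X)
    then have "(y + (\<Sum>i\<in>X. z $ i *\<^sub>R axis i 1)) + z $ x *\<^sub>R axis x 1 \<in> ?H"
      by (intro hull_add_axis[OF U] z)
    then show ?case using insert by (simp add: ac_simps)
  qed (simp add: y)
  then have "y + (\<Sum>i\<in>UNIV. z $ i *\<^sub>R axis i 1) \<in> ?H" by simp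
  moreover have "(\<Sum>i\<in>UNIV. z $ i *\<^sub>R axis i 1) = z"
    using basis_expansion[of z] by (simp add: scalar_mult_eq_scaleR)
  ultimately show ?thesis by simp
qed

text \<open>The right-hand side is convex and contains all exponent vectors, hence the hull.
  Conversely, each of its points is a convex combination of points dominating the generators
  \<open>x_i^(a i)\<close>.\<close>

lemma newton_polyhedron_pure:
  fixes a :: "'n::finite \<Rightarrow> nat"
  assumes pos: "\<forall>i\<in>S. 0 < a i"
  shows "newton_polyhedron (mon_ideal (pure_upset S a) :: ('n, 'k::field) mpoly set) =
    {y. (\<forall>i. 0 \<le> y $ i) \<and> 1 \<le> (\<Sum>i\<in>S. y $ i / real (a i))}" (is "_ = ?P")
proof -
  let ?H = "convex hull (exponent_vector ` pure_upset S a)"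
  have "convex ?P"
  proof (rule convexI)
    fix x y :: "real ^ 'n" and u v :: real
    assume xy: "x \<in> ?P" "y \<in> ?P" and uv: "0 \<le> u" "0 \<le> v" "u + v = 1"
    have "1 = u * 1 + v * 1" using uv by simp
    also have "\<dots> \<le> u * (\<Sum>i\<in>S. x $ i / real (a i)) + v * (\<Sum>i\<in>S. y $ i / real (a i))"
      using xy uv by (intro add_mono mult_left_mono) auto
    also have "\<dots> = (\<Sum>i\<in>S. (u *\<^sub>R x + v *\<^sub>R y) $ i / real (a i))"
      by (simp add: sum_distrib_left sum.distrib add_divide_distrib)
    finally show "u *\<^sub>R x + v *\<^sub>R y \<in> ?P" using xy uv by simp
  qed
  moreover have "exponent_vector ` pure_upset S a \<subseteq> ?P"
  proof (intro subsetI, elim imageE)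
    fix x e assume x: "x = exponent_vector e" "e \<in> pure_upset S a"
    then obtain i where i: "i \<in> S" "a i \<le> lookup e i" unfolding pure_upset_def by blast
    have "1 \<le> real (lookup e i) / real (a i)" using i pos by simp
    also have "\<dots> \<le> (\<Sum>i\<in>S. real (lookup e i) / real (a i))"
      using i(1) by (intro member_le_sum) auto
    finally show "x \<in> ?P" using x by simp
  qed
  ultimately have "?H \<subseteq> ?P" by (intro hull_minimal)
  moreover have "?P \<subseteq> ?H"
  proof
    fix y assume y: "y \<in> ?P"
    define T where "T = (\<Sum>i\<in>S. y $ i / real (a i))"
    have T: "1 \<le> T" using y by (simp add: T_def)
    \<comment> \<open>\<open>z i\<close> keeps the coordinates of \<open>y\<close> outside
      \<open>S\<close> and puts all weight on \<open>S\<close> into coordinate \<open>i\<close>. As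
      \<open>T \<ge> 1\<close>, it dominates the exponent of \<open>x_i^(a i)\<close>; the weights
      \<open>y $ i / a i / T\<close> sum to 1 and recombine the \<open>z i\<close> to
      \<open>y\<close>.\<close>
    define z :: "'n \<Rightarrow> real ^ 'n"
      where "z i = (\<chi> j. if j \<in> S then (if j = i then T * real (a i) else 0) else y $ j)" for i
    have zH: "z i \<in> ?H" if "i \<in> S" for i
    proof -
      have "exponent_vector (single i (a i)) \<in> ?H"
        using that by (intro hull_inc imageI) (auto simp: pure_upset_def intro!: bexI[of _ i])
      moreover have "0 \<le> (z i - exponent_vector (single i (a i))) $ j" for j
        using y T that mult_right_mono[OF T, of "real (a i)"] by (simp add: z_def lookup_single when_def)
      ultimately have "exponent_vector (single i (a i)) + (z i - exponent_vector (single i (a i))) \<in> ?H"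
        by (rule hull_add_nonneg[OF upset_pure])
      then show ?thesis by simp
    qed
    have one: "(\<Sum>i\<in>S. y $ i / real (a i) / T) = 1"
      unfolding sum_divide_distrib[symmetric] T_def[symmetric] using T by simp
    have "(\<Sum>i\<in>S. (y $ i / real (a i) / T) *\<^sub>R z i) \<in> ?H"
      using y T zH one by (intro convex_sum) auto
    moreover have "(\<Sum>i\<in>S. (y $ i / real (a i) / T) *\<^sub>R z i) = y"
    proof (rule vec_eq_iff[THEN iffD2, rule_format])
      fix j
      show "(\<Sum>i\<in>S. (y $ i / real (a i) / T) *\<^sub>R z i) $ j = y $ j"
      proof (cases "j \<in> S")
        case True
        then have "(\<Sum>i\<in>S. (y $ i / real (a i) / T) *\<^sub>R z i) $ j =
            (\<Sum>i\<in>S. if j = i then y $ i / real (a i) / T * (T * real (a i)) else 0)"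
          unfolding sum_component by (intro sum.cong refl) (simp add: z_def)
        also have "\<dots> = y $ j / real (a j) / T * (T * real (a j))"
          using True by (subst sum.delta') auto
        also have "\<dots> = y $ j" using True T pos by simp
        finally show ?thesis .
      next
        case False
        then have "(\<Sum>i\<in>S. (y $ i / real (a i) / T) *\<^sub>R z i) $ j =
            (\<Sum>i\<in>S. y $ i / real (a i) / T) * y $ j"
          by (simp add: z_def sum_distrib_right)
        then show ?thesis using one by simp
      qed
    qed
    ultimately show "y \<in> ?H" by simp
  qed
  ultimately show ?thesis unfolding newton_polyhedron_mon_ideal by blast
qed

subsection \<open>Powers of pure power ideals and least degrees\<close>

text \<open>The weight \<open>w\<close> is additive, nonnegative and at least 1 on the exponents of
  the ideal, so each further factor raises the lower bound by 1. The sets \<open>V m\<close> are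
  up-closed, so the bound passes to the generated ideal.\<close>

lemma keys_ideal_power_pure:
  fixes p :: "('n::finite, 'k::field) mpoly"
  assumes pos: "\<forall>i\<in>S. 0 < a i"
    and "p \<in> ideal_power (mon_ideal (pure_upset S a)) m" and "e \<in> keys p"
  shows "real m \<le> (\<Sum>i\<in>S. real (lookup e i) / real (a i))"
proof -
  define w where "w e = (\<Sum>i\<in>S. real (lookup e i) / real (a i))" for e
  define V where "V m = {e. real m \<le> w e}" for m
  have w_add: "w (d + e) = w d + w e" for d e
    by (simp add: w_def lookup_add add_divide_distrib sum.distrib)
  have w_nonneg: "0 \<le> w e" for e
    by (simp add: w_def sum_nonneg)
  have upset: "upset (V m)" for m
    unfolding upset_def V_def using w_nonneg by (auto simp: w_add intro: add_increasing2)
  have w_pure: "1 \<le> w e" if e: "e \<in> pure_upset S a" for e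
  proof -
    obtain i where i: "i \<in> S" "a i \<le> lookup e i" using e unfolding pure_upset_def by blast
    then have "1 \<le> real (lookup e i) / real (a i)" using pos by simp
    also have "\<dots> \<le> w e" unfolding w_def using i(1) by (intro member_le_sum) auto
    finally show ?thesis .
  qed
  have "ideal_power (mon_ideal (pure_upset S a)) m \<subseteq> (mon_ideal (V m) :: ('n, 'k) mpoly set)"
  proof (induction m)
    case 0
    show ?case by (simp add: V_def w_nonneg)
  next
    case (Suc m)
    have "x * y \<in> mon_ideal (V (Suc m))"
      if x: "x \<in> mon_ideal (pure_upset S a)" and "y \<in> ideal_power (mon_ideal (pure_upset S a)) m"
      for x y :: "('n, 'k) mpoly"
    proof -
      have y: "y \<in> mon_ideal (V m)" using that Suc by blast
      have "k \<in> V (Suc m)" if k: "k \<in> keys (x * y)" for k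
      proof -
        obtain c d where cd: "k = c + d" "c \<in> keys x" "d \<in> keys y" using k keys_mult[of x y] by blast
        then have "1 \<le> w c" "real m \<le> w d" using x y w_pure unfolding mon_ideal_def V_def by auto
        then show ?thesis unfolding V_def by (simp add: cd(1) w_add)
      qed
      then show ?thesis by (auto simp: mon_ideal_def)
    qed
    then show ?case by (simp add: ideal_product_subset[OF is_ideal_mon_ideal[OF upset]])
  qed
  then have "e \<in> V m" using assms(2,3) unfolding mon_ideal_def by blast
  then show ?thesis unfolding V_def w_def by simp
qed

text \<open>Each induction step splits off one generator \<open>x_i^(a i)\<close>, which lowers the
  quotient at \<open>i\<close> by exactly 1 and leaves the others alone.\<close>

lemma monomial_in_ideal_power_pure:
  fixes a :: "'n::finite \<Rightarrow> nat"
  assumes pos: "\<forall>i\<in>S. 0 < a i" and "m \<le> (\<Sum>i\<in>S. lookup e i div a i)"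
  shows "(monomial e :: ('n, 'k::field) mpoly) \<in> ideal_power (mon_ideal (pure_upset S a)) m"
  using assms(2)
proof (induction m arbitrary: e)
  case (Suc m)
  then have "(\<Sum>i\<in>S. lookup e i div a i) \<noteq> 0" by linarith
  then obtain i where i: "i \<in> S" "lookup e i div a i \<noteq> 0" by (meson sum.neutral)
  then have le: "a i \<le> lookup e i" by (metis div_less not_le)
  define d where "d = e - single i (a i)"
  have d: "lookup d j = (if j = i then lookup e i - a i else lookup e j)" for j
    by (auto simp: d_def lookup_minus lookup_single when_def)
  have e: "e = single i (a i) + d"
    using le by (intro poly_mapping_eqI) (auto simp: lookup_add d lookup_single when_def)
  have "(\<Sum>j\<in>S. lookup e j div a j) = Suc (\<Sum>j\<in>S. lookup d j div a j)"
  proof -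
    have "lookup e i div a i = Suc (lookup d i div a i)"
      using le pos i(1) by (simp add: d le_div_geq)
    moreover have "(\<Sum>j\<in>S - {i}. lookup e j div a j) = (\<Sum>j\<in>S - {i}. lookup d j div a j)"
      by (intro sum.cong) (auto simp: d)
    ultimately show ?thesis using i(1) by (simp add: sum.remove[of S i])
  qed
  then have "(monomial d :: ('n, 'k) mpoly) \<in> ideal_power (mon_ideal (pure_upset S a)) m"
    using Suc by simp
  moreover have "(monomial (single i (a i)) :: ('n, 'k) mpoly) \<in> mon_ideal (pure_upset S a)"
    using i(1) by (auto simp: pure_upset_def intro!: bexI[of _ i])
  ultimately have "(monomial (single i (a i)) * monomial d :: ('n, 'k) mpoly)
      \<in> ideal_product (mon_ideal (pure_upset S a)) (ideal_power (mon_ideal (pure_upset S a)) m)"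
    by (rule mult_in_ideal_product[rotated])
  then show ?case unfolding e monomial_mult by simp
qed simp

lemma alpha_le:
  fixes J :: "('n::finite, 'k::field) mpoly set"
  assumes "monomial e \<in> J"
  shows "alpha J \<le> (\<Sum>i\<in>UNIV. lookup e i)"
proof -
  have "total_degree (monomial e :: ('n, 'k) mpoly) = (\<Sum>i\<in>UNIV. lookup e i)"
    by (simp add: total_degree_def monomial_def)
  then show ?thesis unfolding alpha_def using assms by (intro Least_le bexI[of _ "monomial e"]) simp_all
qed

text \<open>The exponent found belongs to some polynomial in \<open>J\<close>; this suffices, since
  \<open>keys_ideal_power_pure\<close> bounds every exponent of every member.\<close>

lemma alpha_attained:
  fixes J :: "('n::finite, 'k::field) mpoly set"
  assumes "p \<in> J" and "p \<noteq> 0"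
  obtains q e where "q \<in> J" and "e \<in> keys q" and "(\<Sum>i\<in>UNIV. lookup e i) = alpha J"
proof -
  have "\<exists>q\<in>J. q \<noteq> 0 \<and> total_degree q = alpha J"
    unfolding alpha_def using assms
    by (intro LeastI_ex[of "\<lambda>d. \<exists>p\<in>J. p \<noteq> 0 \<and> total_degree p = d"]) blast
  then obtain q where q: "q \<in> J" "q \<noteq> 0" "total_degree q = alpha J" by blast
  have "total_degree q \<in> (\<lambda>e. \<Sum>i\<in>UNIV. lookup e i) ` keys q"
    unfolding total_degree_def using q(2) by (intro Max_in) auto
  then show ?thesis using that q by auto
qed

section \<open>Linear optimization over the irreducible polyhedron\<close>

text \<open>\<open>P\<close> may be unbounded, but its part with coordinate sum at most that of a
  given point is compact: nonnegative coordinates are bounded by their sum.\<close>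

lemma linear_min_attained:
  fixes P :: "(real ^ 'n) set"
  assumes "closed P" and "P \<noteq> {}" and nonneg: "\<And>y i. y \<in> P \<Longrightarrow> 0 \<le> y $ i"
  obtains y where "y \<in> P" and "\<And>z. z \<in> P \<Longrightarrow> (\<Sum>i\<in>UNIV. y $ i) \<le> (\<Sum>i\<in>UNIV. z $ i)"
proof -
  let ?f = "\<lambda>y :: real ^ 'n. \<Sum>i\<in>UNIV. y $ i"
  have cont: "continuous_on X ?f" for X by (intro continuous_intros)
  obtain x where x: "x \<in> P" using \<open>P \<noteq> {}\<close> by blast
  define K where "K = P \<inter> {y. ?f y \<le> ?f x}"
  have "closed K"
    unfolding K_def using \<open>closed P\<close> by (intro closed_Int closed_Collect_le cont continuous_on_const)
  moreover have "K \<subseteq> cbox 0 (\<chi> i. ?f x)"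
  proof
    fix y assume "y \<in> K"
    then have y: "y \<in> P" "?f y \<le> ?f x" unfolding K_def by auto
    have "y $ i \<le> ?f y" for i using nonneg[OF y(1)] by (intro member_le_sum) auto
    then show "y \<in> cbox 0 (\<chi> i. ?f x)"
      using nonneg[OF y(1)] y(2) by (auto simp: mem_box_cart intro: order_trans)
  qed
  ultimately have "compact K"
    using bounded_subset[OF bounded_cbox] by (auto simp: compact_eq_bounded_closed)
  moreover have "x \<in> K" using x unfolding K_def by simp
  ultimately obtain y where "y \<in> K" "\<And>z. z \<in> K \<Longrightarrow> ?f y \<le> ?f z"
    using continuous_attains_inf[OF _ _ cont, of K] by blast
  then show ?thesis using that[of y] unfolding K_def by force
qed

theorem corollary4p7:
  fixes I :: "('n::finite, 'k::field) mpoly set"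
  assumes "monomial_ideal I" and "I \<noteq> {0}" and "I \<noteq> UNIV"
  shows "(\<lambda>m. real (alpha (irreducible_power I m)) / real m) \<longlonglongrightarrow> naive_waldschmidt I
    \<and> (\<exists>y\<in>irreducible_polyhedron I. (\<Sum>i\<in>UNIV. y $ i) = naive_waldschmidt I)
    \<and> (\<forall>y\<in>irreducible_polyhedron I. naive_waldschmidt I \<le> (\<Sum>i\<in>UNIV. y $ i))"
proof -
  let ?\<J> = "irreducible_components I" and ?P = "irreducible_polyhedron I"
  have dec: "irreducible_decomposition I ?\<J>"
    using assms by (intro irreducible_components_decomposition)
  \<comment> \<open>The empty family has intersection \<open>UNIV\<close>, so properness of
    \<open>I\<close> gives at least one component; this forces nonnegative coordinates on the
    polyhedron.\<close>
  then have fin: "finite ?\<J>" and ne: "?\<J> \<noteq> {}" and I: "I = \<Inter>?\<J>"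
    using assms(3) unfolding irreducible_decomposition_def by auto
  have "\<forall>J\<in>?\<J>. \<exists>S a. (\<forall>i\<in>S. 0 < a i) \<and> J = mon_ideal (pure_upset S a)"
    using dec irreducible_monomial_ideal_pure unfolding irreducible_decomposition_def by metis
  then obtain S a where pos: "\<And>J. J \<in> ?\<J> \<Longrightarrow> \<forall>i\<in>S J. 0 < a J i"
    and J: "\<And>J. J \<in> ?\<J> \<Longrightarrow> J = mon_ideal (pure_upset (S J) (a J))"
    by metis
  have P: "y \<in> ?P \<longleftrightarrow> (\<forall>i. 0 \<le> y $ i) \<and> (\<forall>J\<in>?\<J>. 1 \<le> (\<Sum>i\<in>S J. y $ i / real (a J i)))" for y
  proof -
    have "y \<in> newton_polyhedron J \<longleftrightarrow> (\<forall>i. 0 \<le> y $ i) \<and> 1 \<le> (\<Sum>i\<in>S J. y $ i / real (a J i))"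
      if "J \<in> ?\<J>" for J
      by (subst J[OF that]) (simp add: newton_polyhedron_pure[OF pos[OF that]])
    then show ?thesis using ne unfolding irreducible_polyhedron_def by auto
  qed
  have "closed (newton_polyhedron J)" if "J \<in> ?\<J>" for J
    using pos[OF that] by (subst J[OF that]) (auto simp: newton_polyhedron_pure[OF pos[OF that]]
      intro!: closed_Collect_conj closed_Collect_all closed_Collect_le continuous_intros)
  then have "closed ?P" unfolding irreducible_polyhedron_def by auto
  moreover have "?P \<noteq> {}"
  \<comment> \<open>A nonzero monomial ideal contains a monomial, whose exponent vector lies in the
    Newton polyhedron of every component.\<close>
  proof -
    obtain U where U: "I = mon_ideal U" using assms(1) unfolding monomial_ideal_iff by blast
    have "U \<noteq> {}" using assms(2) unfolding U mon_ideal_def by auto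
    then obtain e where "monomial e \<in> I" unfolding U by auto
    then have "\<forall>J\<in>?\<J>. monomial e \<in> J" using I by blast
    then have "exponent_vector e \<in> ?P"
      unfolding irreducible_polyhedron_def newton_polyhedron_def exponent_vector_def
      by (auto intro!: hull_inc)
    then show ?thesis by blast
  qed
  ultimately obtain y where y: "y \<in> ?P" and least: "\<And>z. z \<in> ?P \<Longrightarrow> (\<Sum>i\<in>UNIV. y $ i) \<le> (\<Sum>i\<in>UNIV. z $ i)"
    using linear_min_attained[of ?P] P by blast
  define v where "v = (\<Sum>i\<in>UNIV. y $ i)"
  \<comment> \<open>A bound on all generator exponents, independent of \<open>m\<close>; it
    compensates for the floors in the membership criterion.\<close>
  define C where "C = Max ((\<lambda>(J, i). a J i) ` (?\<J> \<times> UNIV))"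
  have C: "a J i \<le> C" if "J \<in> ?\<J>" for J i
    unfolding C_def using fin that by (intro Max_ge) auto
  define E where "E m = Abs_poly_mapping (\<lambda>i. nat \<lceil>real m * y $ i\<rceil> + C)" for m :: nat
  have E: "real m * y $ i + C \<le> lookup (E m) i" "lookup (E m) i \<le> real m * y $ i + 1 + C" for m i
    using y P by (auto simp: E_def)
  have mem: "monomial (E m) \<in> irreducible_power I m" for m
    unfolding irreducible_power_def
  proof
    fix J assume "J \<in> ?\<J>"
    note pos = pos[OF \<open>J \<in> ?\<J>\<close>]
    \<comment> \<open>Since \<open>C \<ge> a J i\<close>, the added constant contributes at least 1
      after division by \<open>a J i\<close>, which pays for rounding the quotient down.\<close>
    have div: "real m * (y $ i / real (a J i)) \<le> real (lookup (E m) i div a J i)" if "i \<in> S J" for i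
    proof -
      have "real m * (y $ i / real (a J i)) + 1 = (real m * y $ i + real (a J i)) / real (a J i)"
        using pos that by (simp add: add_divide_distrib)
      also have "\<dots> \<le> real (lookup (E m) i) / real (a J i)"
        using E(1)[of m i] C[OF \<open>J \<in> ?\<J>\<close>, of i] by (intro divide_right_mono) auto
      also have "\<dots> \<le> real (lookup (E m) i div a J i) + 1"
        using floor_divide_of_nat_eq[of "lookup (E m) i" "a J i", where ?'a = real] by linarith
      finally show ?thesis by simp
    qed
    have "real m * 1 \<le> real m * (\<Sum>i\<in>S J. y $ i / real (a J i))"
      using y P \<open>J \<in> ?\<J>\<close> by (intro mult_left_mono) auto
    also have "\<dots> \<le> (\<Sum>i\<in>S J. real (lookup (E m) i div a J i))"
      unfolding sum_distrib_left by (intro sum_mono div)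
    finally have "m \<le> (\<Sum>i\<in>S J. lookup (E m) i div a J i)"
      by (simp flip: of_nat_sum)
    then show "monomial (E m) \<in> ideal_power J m"
      by (subst J[OF \<open>J \<in> ?\<J>\<close>]) (rule monomial_in_ideal_power_pure[OF pos])
  qed
  have upper: "real (alpha (irreducible_power I m)) / real m \<le> v + CARD('n) * (1 + real C) / real m"
    if "0 < m" for m
  proof -
    have "real (alpha (irreducible_power I m)) \<le> (\<Sum>i\<in>UNIV. real (lookup (E m) i))"
      using alpha_le[OF mem[of m]] by (simp flip: of_nat_sum)
    also have "\<dots> \<le> (\<Sum>i\<in>UNIV. real m * y $ i + (1 + real C))"
      using E(2)[of m] by (intro sum_mono) (simp add: add.assoc)
    also have "\<dots> = real m * v + CARD('n) * (1 + real C)"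
      by (simp add: v_def sum.distrib sum_distrib_left)
    finally show ?thesis using that by (simp add: field_simps)
  qed
  have lower: "v \<le> real (alpha (irreducible_power I m)) / real m" if "0 < m" for m
  proof -
    obtain p e where p: "p \<in> irreducible_power I m" "e \<in> keys p"
      and e: "(\<Sum>i\<in>UNIV. lookup e i) = alpha (irreducible_power I m)"
      by (rule alpha_attained[OF mem[of m] monomial_nonzero])
    \<comment> \<open>An exponent of least degree, scaled by \<open>1 / m\<close>, is feasible, so
      its coordinate sum is at least the optimum \<open>v\<close>.\<close>
    have "(1 / real m) *\<^sub>R exponent_vector e \<in> ?P"
      unfolding P
    proof (intro conjI allI ballI)
      fix J assume "J \<in> ?\<J>"
      then have "p \<in> ideal_power (mon_ideal (pure_upset (S J) (a J))) m"
        using p(1) J unfolding irreducible_power_def by force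
      then have "real m \<le> (\<Sum>i\<in>S J. real (lookup e i) / real (a J i))"
        by (rule keys_ideal_power_pure[OF pos[OF \<open>J \<in> ?\<J>\<close>] _ p(2)])
      then have "1 \<le> (\<Sum>i\<in>S J. real (lookup e i) / real (a J i)) / real m"
        using that by simp
      then show "1 \<le> (\<Sum>i\<in>S J. ((1 / real m) *\<^sub>R exponent_vector e) $ i / real (a J i))"
        by (simp add: sum_divide_distrib mult.commute)
    qed simp
    from least[OF this] have "v \<le> (\<Sum>i\<in>UNIV. real (lookup e i) / real m)"
      by (simp add: v_def)
    also have "\<dots> = real (alpha (irreducible_power I m)) / real m"
      by (simp flip: e sum_divide_distrib)
    finally show ?thesis .
  qed
  have "(\<lambda>m. v + CARD('n) * (1 + real C) / real m) \<longlonglongrightarrow> v + 0"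
    by (intro tendsto_add tendsto_const lim_const_over_n)
  \<comment> \<open>The bounds start at \<open>m = 1\<close>: for \<open>m = 0\<close> the quotient
    is 0 by the convention on division.\<close>
  moreover have "\<forall>\<^sub>F m in sequentially. v \<le> real (alpha (irreducible_power I m)) / real m"
    by (rule eventually_sequentiallyI[of 1]) (simp add: lower)
  moreover have "\<forall>\<^sub>F m in sequentially.
      real (alpha (irreducible_power I m)) / real m \<le> v + CARD('n) * (1 + real C) / real m"
    by (rule eventually_sequentiallyI[of 1]) (rule upper, simp)
  ultimately have lim: "(\<lambda>m. real (alpha (irreducible_power I m)) / real m) \<longlonglongrightarrow> v"
    using tendsto_sandwich[OF _ _ tendsto_const] by simp
  then have "naive_waldschmidt I = v" unfolding naive_waldschmidt_def by (rule limI)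
  then show ?thesis using lim y least unfolding v_def by auto
qed

end
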